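(* Let $A\subseteq\mathrm{Ag}$ and let $\mathsf{L}_1,\mathsf{L}_2$ be logics with fixed-point operators such that $\mathsf{L}_1(\alpha)=\mathsf{L}_2(\alpha)\cup\{T\}$ for $\alpha\in A$ and $\mathsf{L}_1(\alpha)=\mathsf{L}_2(\alpha)$ otherwise, and such that each $\mathsf{L}_2(\alpha)$ is contained in $\{D,B\}$. Then a formula $\varphi$ is $\mathsf{L}_1$-satisfiable if and only if $\mathrm{tr}^{T}_A(\varphi)$ is $\mathsf{L}_2$-satisfiable, where $\mathrm{tr}^T_A$ commutes with all connectives and fixed-point operators (and is the identity on $p,\neg p,\mathtt{tt},\mathtt{ff},X$) except that, for $\alpha\in A$, $\mathrm{tr}^T_A([\alpha]\psi)=[\alpha]\mathrm{tr}^T_A(\psi)\wedge\mathrm{tr}^T_A(\psi)$ and $\mathrm{tr}^T_A(\langle\alpha\rangle\psi)=\langle\alpha\rangle\mathrm{tr}^T_A(\psi)\vee\mathrm{tr}^T_A(\psi)$.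
   Context: Formulas: $\varphi ::= p \mid \neg p \mid \mathtt{tt} \mid \mathtt{ff} \mid X \mid \varphi\wedge\varphi \mid \varphi\vee\varphi \mid \langle\alpha\rangle\varphi \mid [\alpha]\varphi \mid \mu X.\varphi \mid \nu X.\varphi$ over a finite agent set $\mathrm{Ag}$ and finitely many propositional variables; closed formulas only; interpreted on Kripke models $(W,R,V)$, $R\subseteq W\times\mathrm{Ag}\times W$, with the semantics of the multi-agent modal $\mu$-calculus. Frame conditions on $R_\alpha$: $D$ serial, $T$ reflexive, $B$ symmetric. A logic $\mathsf{L}$ assigns to each agent a set $\mathsf{L}(\alpha)$ of conditions; $\mathsf{L}$-models are Kripke models where each $R_\alpha$ satisfies $\mathsf{L}(\alpha)$; $\varphi$ is $\mathsf{L}$-satisfiable if true at some state of some $\mathsf{L}$-model. *)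

theory Defs
  imports Main
begin

text \<open>
  The finite set of agents and the finite set of propositional variables are the type
  parameters \<open>'ag\<close> and \<open>'p\<close> (of class \<open>finite\<close> in the theorem); fixed-point variables are
  natural numbers.
\<close>

datatype ('ag, 'p) form =
    Prop 'p
  | NProp 'p
  | TT
  | FF
  | Var nat
  | And "('ag, 'p) form" "('ag, 'p) form"
  | Or "('ag, 'p) form" "('ag, 'p) form"
  | Dia 'ag "('ag, 'p) form"
  | Box 'ag "('ag, 'p) form"
  | Mu nat "('ag, 'p) form"
  | Nu nat "('ag, 'p) form"

primrec free_vars :: "('ag, 'p) form \<Rightarrow> nat set" where
  "free_vars (Prop p) = {}"
| "free_vars (NProp p) = {}"
| "free_vars TT = {}"
| "free_vars FF = {}"
| "free_vars (Var X) = {X}"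
| "free_vars (And \<phi> \<psi>) = free_vars \<phi> \<union> free_vars \<psi>"
| "free_vars (Or \<phi> \<psi>) = free_vars \<phi> \<union> free_vars \<psi>"
| "free_vars (Dia \<alpha> \<phi>) = free_vars \<phi>"
| "free_vars (Box \<alpha> \<phi>) = free_vars \<phi>"
| "free_vars (Mu X \<phi>) = free_vars \<phi> - {X}"
| "free_vars (Nu X \<phi>) = free_vars \<phi> - {X}"

definition closed_form :: "('ag, 'p) form \<Rightarrow> bool" where
  "closed_form \<phi> \<longleftrightarrow> free_vars \<phi> = {}"

record ('w, 'ag, 'p) kripke =
  worlds :: "'w set"
  acc :: "('w \<times> 'ag \<times> 'w) set"
  val :: "'w \<Rightarrow> 'p set"

definition kripke_model :: "('w, 'ag, 'p) kripke \<Rightarrow> bool" where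
  "kripke_model M \<longleftrightarrow> worlds M \<noteq> {} \<and> acc M \<subseteq> worlds M \<times> UNIV \<times> worlds M"

definition agent_rel :: "('w, 'ag, 'p) kripke \<Rightarrow> 'ag \<Rightarrow> 'w rel" where
  "agent_rel M \<alpha> = {(w, v). (w, \<alpha>, v) \<in> acc M}"

primrec sem :: "('w, 'ag, 'p) kripke \<Rightarrow> ('ag, 'p) form \<Rightarrow> (nat \<Rightarrow> 'w set) \<Rightarrow> 'w set" where
  "sem M (Prop p) \<rho> = {w \<in> worlds M. p \<in> val M w}"
| "sem M (NProp p) \<rho> = {w \<in> worlds M. p \<notin> val M w}"
| "sem M TT \<rho> = worlds M"
| "sem M FF \<rho> = {}"
| "sem M (Var X) \<rho> = \<rho> X"
| "sem M (And \<phi> \<psi>) \<rho> = sem M \<phi> \<rho> \<inter> sem M \<psi> \<rho>"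
| "sem M (Or \<phi> \<psi>) \<rho> = sem M \<phi> \<rho> \<union> sem M \<psi> \<rho>"
| "sem M (Dia \<alpha> \<phi>) \<rho> = {w \<in> worlds M. \<exists>v. (w, v) \<in> agent_rel M \<alpha> \<and> v \<in> sem M \<phi> \<rho>}"
| "sem M (Box \<alpha> \<phi>) \<rho> = {w \<in> worlds M. \<forall>v. (w, v) \<in> agent_rel M \<alpha> \<longrightarrow> v \<in> sem M \<phi> \<rho>}"
| "sem M (Mu X \<phi>) \<rho> = \<Inter>{S. S \<subseteq> worlds M \<and> sem M \<phi> (\<rho>(X := S)) \<subseteq> S}"
| "sem M (Nu X \<phi>) \<rho> = \<Union>{S. S \<subseteq> worlds M \<and> S \<subseteq> sem M \<phi> (\<rho>(X := S))}"

text \<open>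
  Truth at a state is only meant for closed formulas, whose semantics does not depend on the
  environment; the empty environment is an arbitrary choice.
\<close>

definition holds_at :: "('w, 'ag, 'p) kripke \<Rightarrow> 'w \<Rightarrow> ('ag, 'p) form \<Rightarrow> bool" where
  "holds_at M w \<phi> \<longleftrightarrow> w \<in> sem M \<phi> (\<lambda>_. {})"

datatype frame_cond = D | T | B

definition satisfies_cond :: "'w set \<Rightarrow> 'w rel \<Rightarrow> frame_cond \<Rightarrow> bool" where
  "satisfies_cond W R c \<longleftrightarrow>
    (case c of
       D \<Rightarrow> \<forall>w\<in>W. \<exists>v\<in>W. (w, v) \<in> R
     | T \<Rightarrow> refl_on W R
     | B \<Rightarrow> sym R)"

type_synonym 'ag logic = "'ag \<Rightarrow> frame_cond set"

definition model_of :: "'ag logic \<Rightarrow> ('w, 'ag, 'p) kripke \<Rightarrow> bool" where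
  "model_of L M \<longleftrightarrow>
    kripke_model M \<and> (\<forall>\<alpha>. \<forall>c \<in> L \<alpha>. satisfies_cond (worlds M) (agent_rel M \<alpha>) c)"

text \<open>
  HOL cannot quantify existentially over types inside a formula, so satisfiability carries the
  type \<open>'w\<close> from which states are drawn. The set of states is an arbitrary nonempty subset of
  \<open>'w\<close>, and \<open>'w\<close> itself is an arbitrary type.
\<close>

definition satisfiable :: "'w itself \<Rightarrow> 'ag logic \<Rightarrow> ('ag, 'p) form \<Rightarrow> bool" where
  "satisfiable _ L \<phi> \<longleftrightarrow>
    (\<exists>(M :: ('w, 'ag, 'p) kripke) w. model_of L M \<and> w \<in> worlds M \<and> holds_at M w \<phi>)"

primrec trT :: "'ag set \<Rightarrow> ('ag, 'p) form \<Rightarrow> ('ag, 'p) form" where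
  "trT A (Prop p) = Prop p"
| "trT A (NProp p) = NProp p"
| "trT A TT = TT"
| "trT A FF = FF"
| "trT A (Var X) = Var X"
| "trT A (And \<phi> \<psi>) = And (trT A \<phi>) (trT A \<psi>)"
| "trT A (Or \<phi> \<psi>) = Or (trT A \<phi>) (trT A \<psi>)"
| "trT A (Dia \<alpha> \<phi>) =
    (if \<alpha> \<in> A then Or (Dia \<alpha> (trT A \<phi>)) (trT A \<phi>) else Dia \<alpha> (trT A \<phi>))"
| "trT A (Box \<alpha> \<phi>) =
    (if \<alpha> \<in> A then And (Box \<alpha> (trT A \<phi>)) (trT A \<phi>) else Box \<alpha> (trT A \<phi>))"
| "trT A (Mu X \<phi>) = Mu X (trT A \<phi>)"
| "trT A (Nu X \<phi>) = Nu X (trT A \<phi>)"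

end

theory Submission
  imports Defs
begin

text \<open>
  Adding to a model all loops labelled by agents in \<open>A\<close> has the same effect on a formula as
  applying \<open>trT A\<close> to it. Seriality and symmetry survive the addition of loops, and a model that is
  already reflexive for the agents in \<open>A\<close> does not change.
\<close>

text \<open>Loops are placed only at states in \<open>worlds M\<close>, so accessibility stays
  inside the state set. The state type is unchanged, so both directions of the theorem can use the
  same \<open>'w\<close>.\<close>

definition add_loops :: "'ag set \<Rightarrow> ('w, 'ag, 'p) kripke \<Rightarrow> ('w, 'ag, 'p) kripke" where
  "add_loops A M = M\<lparr>acc := acc M \<union> {(w, \<alpha>, w) | w \<alpha>. w \<in> worlds M \<and> \<alpha> \<in> A}\<rparr>"

lemma worlds_add_loops [simp]: "worlds (add_loops A M) = worlds M"
  by (simp add: add_loops_def)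

lemma val_add_loops [simp]: "val (add_loops A M) = val M"
  by (simp add: add_loops_def)

lemma agent_rel_add_loops:
  "agent_rel (add_loops A M) \<alpha> = agent_rel M \<alpha> \<union> (if \<alpha> \<in> A then Id_on (worlds M) else {})"
  by (auto simp: agent_rel_def add_loops_def)

lemma kripke_model_add_loops: "kripke_model M \<Longrightarrow> kripke_model (add_loops A M)"
  by (auto simp: kripke_model_def add_loops_def)

lemma add_loops_refl:
  assumes "\<And>\<alpha>. \<alpha> \<in> A \<Longrightarrow> refl_on (worlds M) (agent_rel M \<alpha>)"
  shows "add_loops A M = M"
proof -
  have "acc M \<union> {(w, \<alpha>, w) | w \<alpha>. w \<in> worlds M \<and> \<alpha> \<in> A} = acc M"
    using assms by (auto simp: refl_on_def agent_rel_def)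
  then show ?thesis by (simp add: add_loops_def)
qed

text \<open>Needed for the diamond case below: the added disjunct may hold only at states that
  actually receive a loop.\<close>

lemma sem_subset_worlds:
  assumes "\<And>X. \<rho> X \<subseteq> worlds M"
  shows "sem M \<phi> \<rho> \<subseteq> worlds M"
  using assms
proof (induction \<phi> arbitrary: \<rho>)
  case (Mu X \<phi>)
  \<comment> \<open>\<open>worlds M\<close> is itself a pre-fixed point, so it belongs to the family
    being intersected and bounds the intersection.\<close>
  have "sem M \<phi> (\<rho>(X := worlds M)) \<subseteq> worlds M"
    using Mu.prems by (intro Mu.IH) simp
  then show ?case by auto
qed (simp_all, blast+)

text \<open>Only modalities of agents in \<open>A\<close> differ. A loop makes each state its own
  successor, so a diamond gains the disjunct, and a box the conjunct, that its argument holds at the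
  state itself.\<close>

lemma sem_add_loops:
  assumes "\<And>X. \<rho> X \<subseteq> worlds M"
  shows "sem (add_loops A M) \<phi> \<rho> = sem M (trT A \<phi>) \<rho>"
  using assms
proof (induction \<phi> arbitrary: \<rho>)
  case (Dia \<alpha> \<phi>)
  have "sem (add_loops A M) \<phi> \<rho> = sem M (trT A \<phi>) \<rho>"
    using Dia.prems by (rule Dia.IH)
  moreover have "sem M (trT A \<phi>) \<rho> \<subseteq> worlds M"
    using Dia.prems by (rule sem_subset_worlds)
  ultimately show ?case
    by (auto simp: agent_rel_add_loops)
next
  case (Box \<alpha> \<phi>)
  have "sem (add_loops A M) \<phi> \<rho> = sem M (trT A \<phi>) \<rho>"
    using Box.prems by (rule Box.IH)
  moreover have "sem M (trT A \<phi>) \<rho> \<subseteq> worlds M"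
    using Box.prems by (rule sem_subset_worlds)
  ultimately show ?case
    by (auto simp: agent_rel_add_loops)
next
  case (Mu X \<phi>)
  \<comment> \<open>The induction hypothesis covers only S \<subseteq> \<open>worlds M\<close>. The
    fixed-point semantics has this as its first conjunct, and \<open>conj_cong\<close> makes it
    available when rewriting the second.\<close>
  have "sem (add_loops A M) \<phi> (\<rho>(X := S)) = sem M (trT A \<phi>) (\<rho>(X := S))"
    if "S \<subseteq> worlds M" for S
    using Mu.prems that by (intro Mu.IH) simp
  then show ?case by (simp cong: conj_cong)
next
  case (Nu X \<phi>)
  have "sem (add_loops A M) \<phi> (\<rho>(X := S)) = sem M (trT A \<phi>) (\<rho>(X := S))"
    if "S \<subseteq> worlds M" for S
    using Nu.prems that by (intro Nu.IH) simp
  then show ?case by (simp cong: conj_cong)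
qed simp_all

lemma holds_at_add_loops: "holds_at (add_loops A M) w \<phi> \<longleftrightarrow> holds_at M w (trT A \<phi>)"
  by (simp add: holds_at_def sem_add_loops)

text \<open>Seriality and reflexivity pass to larger relations; symmetry is kept because the new
  pairs are diagonal.\<close>

lemma satisfies_cond_add_loops:
  assumes "satisfies_cond (worlds M) (agent_rel M \<alpha>) c"
  shows "satisfies_cond (worlds M) (agent_rel (add_loops A M) \<alpha>) c"
  using assms
  by (cases c) (auto simp: satisfies_cond_def agent_rel_add_loops refl_on_def sym_def)

lemma satisfies_T_add_loops:
  "\<alpha> \<in> A \<Longrightarrow> satisfies_cond (worlds M) (agent_rel (add_loops A M) \<alpha>) T"
  by (auto simp: satisfies_cond_def agent_rel_add_loops refl_on_def)

theorem theorem3p16: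
  fixes A :: "'ag::finite set"
    and L1 L2 :: "'ag logic"
    and \<phi> :: "('ag, 'p::finite) form"
  assumes "\<And>\<alpha>. \<alpha> \<in> A \<Longrightarrow> L1 \<alpha> = L2 \<alpha> \<union> {T}"
    and "\<And>\<alpha>. \<alpha> \<notin> A \<Longrightarrow> L1 \<alpha> = L2 \<alpha>"
    and "\<And>\<alpha>. L2 \<alpha> \<subseteq> {D, B}"
    and "closed_form \<phi>"
  shows "satisfiable TYPE('w) L1 \<phi> \<longleftrightarrow> satisfiable TYPE('w) L2 (trT A \<phi>)"
proof
  assume "satisfiable TYPE('w) L1 \<phi>"
  then obtain M :: "('w, 'ag, 'p) kripke" and w
    where M: "model_of L1 M" and w: "w \<in> worlds M" "holds_at M w \<phi>"
    by (auto simp: satisfiable_def)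
  have "refl_on (worlds M) (agent_rel M \<alpha>)" if "\<alpha> \<in> A" for \<alpha>
  proof -
    have "T \<in> L1 \<alpha>" using assms(1) that by simp
    with M have "satisfies_cond (worlds M) (agent_rel M \<alpha>) T" by (auto simp: model_of_def)
    then show ?thesis by (simp add: satisfies_cond_def)
  qed
  \<comment> \<open>Hence \<open>holds_at_add_loops\<close> compares \<phi> and its translation in
    the one model \<open>M\<close>, which is also the witness for \<open>L2\<close>.\<close>
  then have "add_loops A M = M" by (rule add_loops_refl)
  with w have "holds_at M w (trT A \<phi>)" using holds_at_add_loops[of A M w \<phi>] by simp
  moreover have "L2 \<alpha> \<subseteq> L1 \<alpha>" for \<alpha> using assms(1,2) by (cases "\<alpha> \<in> A") auto
  with M have "model_of L2 M" by (auto simp: model_of_def)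
  ultimately show "satisfiable TYPE('w) L2 (trT A \<phi>)"
    using w by (auto simp: satisfiable_def)
next
  assume "satisfiable TYPE('w) L2 (trT A \<phi>)"
  then obtain M :: "('w, 'ag, 'p) kripke" and w
    where M: "model_of L2 M" and w: "w \<in> worlds M" "holds_at M w (trT A \<phi>)"
    by (auto simp: satisfiable_def)
  have "satisfies_cond (worlds M) (agent_rel (add_loops A M) \<alpha>) c" if "c \<in> L1 \<alpha>" for \<alpha> c
  proof (cases "c \<in> L2 \<alpha>")
    case True
    with M show ?thesis by (auto simp: model_of_def intro: satisfies_cond_add_loops)
  next
    case False
    \<comment> \<open>The only condition \<open>L1\<close> can add to those of \<open>L2\<close> is
      \<open>T\<close>, for agents in \<open>A\<close>, and the loops supply it.\<close>
    with that assms(1,2) have "\<alpha> \<in> A" "c = T" by (cases "\<alpha> \<in> A"; auto)+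
    then show ?thesis by (simp add: satisfies_T_add_loops)
  qed
  with M have "model_of L1 (add_loops A M)"
    by (simp add: model_of_def kripke_model_add_loops)
  moreover have "holds_at (add_loops A M) w \<phi>" using w by (simp add: holds_at_add_loops)
  ultimately show "satisfiable TYPE('w) L1 \<phi>"
    using w by (auto simp: satisfiable_def intro!: exI[of _ "add_loops A M"])
qed

end
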